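(* Let $N$ be an odd positive integer with $\sigma^*(\sigma^*(N))=2N$ and $N\neq 9,165$, and write $\sigma^*(N)=2^{f_1}q^{f_2}$ with $q$ an odd prime and $f_1,f_2\ge1$. Then $q\notin\{7,11,13\}$.
   Context: $\sigma^*(n)$ is the sum of the unitary divisors of $n$, i.e. divisors $d$ of $n$ with $\gcd(d,n/d)=1$. For odd $N$ with $\sigma^*(\sigma^*(N))=2N$, $\sigma^*(N)$ is always of the form $2^{f_1}q^{f_2}$ with $q$ an odd prime. *)

theory Defs
  imports "HOL-Computational_Algebra.Primes"
begin

definition unitary_divisors :: "nat \<Rightarrow> nat set" where
  "unitary_divisors n = {d. d dvd n \<and> gcd d (n div d) = 1}"

text \<open>The function \<open>\<sigma>\<^sup>*\<close>. It is only meaningful for positive arguments.\<close>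

definition unitary_sigma :: "nat \<Rightarrow> nat" where
  "unitary_sigma n = (\<Sum>d\<in>unitary_divisors n. d)"

end

theory Submission
  imports Defs "HOL-Number_Theory.Residues" "HOL-Analysis.Infinite_Products"
begin

text \<open>
  By multiplicativity \<open>2N = (2\<^sup>f\<^sup>1 + 1)(q\<^sup>f\<^sup>2 + 1)\<close>, and each prime power \<open>p\<^sup>e\<close> exactly
  dividing \<open>N\<close> satisfies \<open>p\<^sup>e + 1 = 2\<^sup>a q\<^sup>b\<close> with \<open>a \<ge> 1\<close>.

  If \<open>q \<equiv> 3 (mod 4)\<close> and \<open>q > 3\<close>, then \<open>f2\<close> is even, since otherwise \<open>4\<close> divides \<open>2N\<close>. Every
  prime \<open>p\<close> dividing \<open>M = (q\<^sup>f\<^sup>2 + 1)/2\<close> is then \<open>1\<close> modulo \<open>4\<close>, which forces \<open>p\<^sup>e + 1 = 2q\<^sup>b\<close>;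
  here \<open>e\<close> is odd because \<open>-1\<close> is not a square modulo \<open>q\<close>, so \<open>p + 1\<close> divides \<open>2q\<^sup>b\<close> and
  \<open>p \<equiv> -1 (mod q)\<close>. Hence \<open>M \<equiv> \<plusminus>1\<close> although \<open>2M \<equiv> 1 (mod q)\<close>.

  If \<open>q = 13\<close>, compare sizes: the product of \<open>1 - 1/(p\<^sup>e + 1)\<close> over the prime powers exactly
  dividing \<open>N\<close> equals \<open>N/\<sigma>\<^sup>*(N) = (1 + 2\<^sup>-\<^sup>f\<^sup>1)(1 + 13\<^sup>-\<^sup>f\<^sup>2)/2\<close>, which is too small, because the
  numbers \<open>p\<^sup>e + 1\<close> are distinct, of the form \<open>2\<^sup>a 13\<^sup>b\<close>, and different from \<open>2\<close>, \<open>16\<close> and \<open>52\<close>.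
  For \<open>f1 \<le> 3\<close>, where \<open>2\<^sup>-\<^sup>f\<^sup>1\<close> is not small, one uses instead that the exponents \<open>a\<close> add up to \<open>f1\<close>.
\<close>

section \<open>The product formula for the unitary divisor sum\<close>

lemma finite_unitary_divisors: "n > 0 \<Longrightarrow> finite (unitary_divisors n)"
  unfolding unitary_divisors_def by (rule finite_subset[OF _ finite_divisors_nat[of n]]) auto

lemma unitary_divisors_iff:
  "d \<in> unitary_divisors n \<longleftrightarrow> (\<exists>e. n = d * e \<and> coprime d e)" if "n > 0" for n d :: nat
  using that unfolding unitary_divisors_def coprime_iff_gcd_eq_1[symmetric] by auto

text \<open>In a factorization \<open>p ^ k * m = d * e\<close> into coprime factors,
  \<open>p\<close> divides only one of them, and that factor absorbs all of \<open>p ^ k\<close>. So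
  a unitary divisor either avoids \<open>p\<close> or contains exactly \<open>p ^ k\<close>.\<close>

lemma unitary_divisors_prime_power_mult:
  fixes p k m :: nat
  assumes p: "prime p" and k: "k > 0" and m: "m > 0" and pm: "\<not> p dvd m"
  shows "unitary_divisors (p ^ k * m) = unitary_divisors m \<union> (\<lambda>d. p ^ k * d) ` unitary_divisors m"
    (is "?L = ?R")
proof (intro equalityI subsetI)
  have p0: "p > 0" using p prime_gt_0_nat by blast
  have n0: "p ^ k * m > 0" using p0 m by simp
  fix d
  have aux: "\<exists>e'. e = p ^ k * e'" if "p ^ k * m = d * e" "\<not> p dvd d" for d e
  proof -
    have "coprime (p ^ k) d" using p that(2) by (simp add: prime_imp_coprime)
    moreover have "p ^ k dvd d * e" using that(1) by (metis dvd_triv_left)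
    ultimately show ?thesis by (metis coprime_dvd_mult_right_iff dvd_def)
  qed
  {
    assume "d \<in> ?L"
    then obtain e where e: "p ^ k * m = d * e" "coprime d e"
      using unitary_divisors_iff[OF n0] by blast
    show "d \<in> ?R"
    proof (cases "p dvd d")
      case False
      then obtain e' where e': "e = p ^ k * e'" using aux e by blast
      have "m = d * e'" using e(1) e' p0 by simp
      moreover have "coprime d e'" using e(2) e' by simp
      ultimately show ?thesis using unitary_divisors_iff[OF m] by blast
    next
      case True
      hence "\<not> p dvd e" using e(2) p by (metis coprime_common_divisor not_prime_unit)
      then obtain d' where d': "d = p ^ k * d'" using aux[of e d] e by (metis mult.commute)
      have "m = d' * e" using e(1) d' p0 by simp
      moreover have "coprime d' e" using e(2) d' by simp
      ultimately show ?thesis using unitary_divisors_iff[OF m] d' by blast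
    qed
  next
    assume "d \<in> ?R"
    then consider "d \<in> unitary_divisors m"
      | d' where "d = p ^ k * d'" "d' \<in> unitary_divisors m" by blast
    thus "d \<in> ?L"
    proof cases
      case 1
      then obtain e where e: "m = d * e" "coprime d e" using unitary_divisors_iff[OF m] by blast
      have "coprime d (p ^ k)" using pm e(1) p
        by (metis coprime_commute coprime_power_right_iff dvd_mult2 prime_imp_coprime)
      hence "coprime d (p ^ k * e)" using e by simp
      moreover have "p ^ k * m = d * (p ^ k * e)" using e by simp
      ultimately show ?thesis using unitary_divisors_iff[OF n0] by blast
    next
      case 2
      then obtain e where e: "m = d' * e" "coprime d' e" using unitary_divisors_iff[OF m] by blast
      have "coprime (p ^ k) e" using pm e(1) p
        by (metis coprime_commute coprime_power_right_iff dvd_mult prime_imp_coprime)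
      hence "coprime d e" using e 2 by simp
      moreover have "p ^ k * m = d * e" using e 2 by simp
      ultimately show ?thesis using unitary_divisors_iff[OF n0] by blast
    qed
  }
qed

lemma unitary_sigma_prime_power_mult:
  fixes p k m :: nat
  assumes p: "prime p" and k: "k > 0" and m: "m > 0" and pm: "\<not> p dvd m"
  shows "unitary_sigma (p ^ k * m) = (p ^ k + 1) * unitary_sigma m"
proof -
  have fin: "finite (unitary_divisors m)" using m by (rule finite_unitary_divisors)
  have p0: "p > 0" using p prime_gt_0_nat by blast
  have "unitary_divisors m \<inter> (\<lambda>d. p ^ k * d) ` unitary_divisors m = {}"
  proof -
    have "p dvd p ^ k * d" for d using k by (simp add: dvd_power)
    moreover have "\<not> p dvd d" if "d \<in> unitary_divisors m" for d
      using that pm unfolding unitary_divisors_def by (auto intro: dvd_trans)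
    ultimately show ?thesis by blast
  qed
  moreover have "inj_on (\<lambda>d. p ^ k * d) (unitary_divisors m)" using p0 by (auto simp: inj_on_def)
  ultimately show ?thesis
    unfolding unitary_sigma_def unitary_divisors_prime_power_mult[OF assms]
    by (simp add: sum.union_disjoint fin sum.reindex sum.distrib[symmetric] sum_distrib_left algebra_simps)
qed

lemma unitary_sigma_1: "unitary_sigma 1 = 1"
proof -
  have "unitary_divisors 1 = {1}" unfolding unitary_divisors_def by auto
  thus ?thesis unfolding unitary_sigma_def by simp
qed

lemma unitary_sigma_two_prime_powers:
  fixes p q a b :: nat
  assumes "prime p" "prime q" "p \<noteq> q" "a > 0" "b > 0"
  shows "unitary_sigma (p ^ a * q ^ b) = (p ^ a + 1) * (q ^ b + 1)"
proof -
  have "\<not> p dvd q ^ b" using assms by (metis prime_dvd_power primes_dvd_imp_eq)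
  moreover have "unitary_sigma (q ^ b) = q ^ b + 1"
    using unitary_sigma_prime_power_mult[of q b 1] prime_gt_1_nat[of q] assms unitary_sigma_1
    by simp
  ultimately show ?thesis
    using unitary_sigma_prime_power_mult[of p a "q ^ b"] assms prime_gt_0_nat by simp
qed

lemma unitary_sigma_prod:
  fixes S :: "nat set" and f :: "nat \<Rightarrow> nat"
  assumes "finite S" "\<And>p. p \<in> S \<Longrightarrow> prime p" "\<And>p. p \<in> S \<Longrightarrow> f p > 0"
  shows "unitary_sigma (\<Prod>p\<in>S. p ^ f p) = (\<Prod>p\<in>S. p ^ f p + 1)"
  using assms
proof (induction S rule: finite_induct)
  case empty
  show ?case using unitary_sigma_1 by simp
next
  case (insert p S)
  have "\<not> p dvd (\<Prod>p\<in>S. p ^ f p)"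
  proof
    assume "p dvd (\<Prod>p\<in>S. p ^ f p)"
    then obtain r where r: "r \<in> S" "p dvd r ^ f r"
      using insert by (auto simp: prime_dvd_prod_iff)
    moreover have "prime p" "prime r" using insert.prems(1) r(1) by auto
    ultimately have "p = r" by (metis prime_dvd_power primes_dvd_imp_eq)
    thus False using r insert by simp
  qed
  moreover have "(\<Prod>p\<in>S. p ^ f p) > 0" using insert prime_gt_0_nat by (auto intro!: prod_pos)
  ultimately show ?case using insert unitary_sigma_prime_power_mult[of p "f p" "\<Prod>p\<in>S. p ^ f p"]
    by simp
qed

lemma unitary_sigma_eq_prod_prime_factors:
  assumes "N > 0"
  shows "unitary_sigma N = (\<Prod>p\<in>prime_factors N. p ^ multiplicity p N + 1)"
proof -
  have "unitary_sigma (\<Prod>p\<in>prime_factors N. p ^ multiplicity p N)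
      = (\<Prod>p\<in>prime_factors N. p ^ multiplicity p N + 1)"
    by (rule unitary_sigma_prod[OF finite_set_mset]) (auto simp: prime_factors_multiplicity)
  thus ?thesis using prime_factorization_nat[OF assms] by simp
qed

section \<open>Divisibility and congruence tools\<close>

lemma dvd_two_prime_powers:
  fixes p q x a b :: nat
  assumes "prime p" "prime q" "x dvd p ^ a * q ^ b"
  obtains i j where "x = p ^ i * q ^ j"
proof -
  obtain y z where "x = y * z" "y dvd p ^ a" "z dvd q ^ b" using division_decomp[OF assms(3)] by blast
  thus thesis using that assms(1,2) by (auto simp: divides_primepow_nat)
qed

text \<open>If \<open>p = 4 * m + 3\<close>, then \<open>(p - 1) / 2\<close> is the odd number
  \<open>2 * m + 1\<close>. Raising \<open>y ^ 2 = -1\<close> to this power gives -1 modulo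
  \<open>p\<close>, whereas Fermat's theorem gives 1.\<close>

lemma prime_dvd_square_plus_1_mod_4:
  fixes p y :: nat
  assumes p: "prime p" "odd p" and d: "p dvd y ^ 2 + 1"
  shows "p mod 4 = 1"
proof (rule ccontr)
  assume "p mod 4 \<noteq> 1"
  hence "p mod 4 = 3" using \<open>odd p\<close> by presburger
  define m where "m = p div 4"
  have m: "p - 1 = 2 * (2 * m + 1)" using \<open>p mod 4 = 3\<close> unfolding m_def by presburger
  have "\<not> p dvd y"
  proof
    assume "p dvd y"
    hence "p dvd y ^ 2" by (simp add: power2_eq_square)
    hence "p dvd 1" using d by (metis dvd_add_right_iff)
    thus False using p(1) not_prime_unit by blast
  qed
  hence "[y ^ (p - 1) = 1] (mod p)" using p(1) by (rule fermat_theorem[rotated])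
  hence "[int ((y ^ 2) ^ (2 * m + 1)) = int 1] (mod int p)"
    unfolding m power_mult by (simp only: cong_int_iff)
  hence 1: "[(int y ^ 2) ^ (2 * m + 1) = 1] (mod int p)" by simp
  have "int p dvd int (y ^ 2 + 1)" using d by (simp only: of_nat_dvd_iff)
  hence "[int y ^ 2 = -1] (mod int p)" by (simp add: cong_iff_dvd_diff add.commute)
  hence "[(int y ^ 2) ^ (2 * m + 1) = (-1) ^ (2 * m + 1)] (mod int p)" by (rule cong_pow)
  with 1 have "[1 = (-1 :: int)] (mod int p)" by (simp add: cong_def)
  hence "int p dvd 2" by (simp add: cong_iff_dvd_diff)
  hence "p dvd 2" by presburger
  thus False using p by (metis primes_dvd_imp_eq two_is_prime_nat dvd_refl)
qed

lemma plus_1_dvd_odd_power_plus_1: "odd e \<Longrightarrow> p + 1 dvd p ^ e + (1::nat)"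
proof -
  assume "odd e"
  have "[int p = -1] (mod (int p + 1))" by (simp add: cong_iff_dvd_diff)
  hence "[int p ^ e = (-1) ^ e] (mod (int p + 1))" by (rule cong_pow)
  hence "int p + 1 dvd int p ^ e + 1" using \<open>odd e\<close> by (simp add: cong_iff_dvd_diff)
  hence "int (p + 1) dvd int (p ^ e + 1)" by (simp add: add.commute)
  thus ?thesis by (simp only: of_nat_dvd_iff)
qed

text \<open>The sign is the parity of the number of prime factors of \<open>M\<close>, counted with
  multiplicity.\<close>

lemma cong_plus_minus_1_of_prime_factors:
  fixes M :: nat and q :: int
  assumes "M > 0" "\<And>p. prime p \<Longrightarrow> p dvd M \<Longrightarrow> [int p = -1] (mod q)"
  shows "[int M = 1] (mod q) \<or> [int M = -1] (mod q)"
  using assms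
proof (induction M rule: prime_divisors_induct)
  case (factor p x)
  have "[int p = -1] (mod q)" using factor by simp
  moreover have "[int x = 1] (mod q) \<or> [int x = -1] (mod q)" using factor by simp
  ultimately show ?case using cong_mult[of "int p" "-1" q "int x" 1] cong_mult[of "int p" "-1" q "int x" "-1"]
    by auto
qed auto

lemma prime_power_plus_1_form:
  fixes N q p f1 f2 :: nat
  assumes N: "N > 0" "odd N" and q: "prime q" "odd q"
    and sN: "unitary_sigma N = 2 ^ f1 * q ^ f2" and p: "p \<in> prime_factors N"
  shows "\<exists>a b. p ^ multiplicity p N + 1 = 2 ^ a * q ^ b \<and> a \<ge> 1"
proof -
  have "p ^ multiplicity p N + 1 dvd unitary_sigma N"
    unfolding unitary_sigma_eq_prod_prime_factors[OF N(1)]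
    by (rule dvd_prodI) (use p in auto)
  then obtain a b where ab: "p ^ multiplicity p N + 1 = 2 ^ a * q ^ b"
    using dvd_two_prime_powers[OF two_is_prime_nat q(1)] sN by metis
  have "odd p" using N p by (meson dvd_trans in_prime_factors_imp_dvd)
  hence "even (p ^ multiplicity p N + 1)" by simp
  hence "a \<noteq> 0" unfolding ab using q by (cases a) auto
  thus ?thesis using ab by (intro exI[of _ a] exI[of _ b]) auto
qed

section \<open>The case q = 3 (mod 4), which covers 7 and 11\<close>

lemma prime_3_mod_4_impossible:
  fixes N q f1 f2 :: nat
  assumes N: "N > 0" "odd N" and q: "prime q" "q mod 4 = 3" "q \<noteq> 3"
    and f: "f2 \<ge> 1" and sN: "unitary_sigma N = 2 ^ f1 * q ^ f2"
    and eq: "(2 ^ f1 + 1) * (q ^ f2 + 1) = 2 * N"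
  shows False
proof -
  have odd_q: "odd q" using q(2) by presburger
  have "\<not> 4 dvd q ^ f2 + 1"
  proof
    assume "4 dvd q ^ f2 + 1"
    hence "4 dvd 2 * N" using eq by (metis dvd_mult)
    thus False using N by presburger
  qed
  moreover have "4 dvd q + 1" using q(2) by presburger
  ultimately have "even f2" using plus_1_dvd_odd_power_plus_1[of f2 q] dvd_trans by blast
  then obtain k where k: "f2 = 2 * k" by blast
  obtain M where M: "q ^ f2 + 1 = 2 * M" using odd_q by (metis evenE even_add even_power odd_one)
  have M0: "M > 0" using M by (cases M) auto
  have MN: "M dvd N" using eq unfolding M by (metis dvd_triv_right mult.left_commute mult_left_cancel zero_neq_numeral)
  have "[int p = -1] (mod int q)" if p: "prime p" "p dvd M" for p
  proof -
    have pN: "p \<in> prime_factors N" using p MN N by (auto simp: in_prime_factors_iff intro: dvd_trans)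
    define e where "e = multiplicity p N"
    have e0: "e > 0" using pN unfolding e_def by (simp add: prime_factors_multiplicity)
    have odd_p: "odd p" using N p MN by (meson dvd_trans)
    have p1: "p > 1" using p prime_gt_1_nat by blast
    \<comment> \<open>Since \<open>f2 = 2 * k\<close>, the number \<open>2 * M\<close> is a square
      plus 1.\<close>
    have "p dvd (q ^ k) ^ 2 + 1" using p(2) M k by (metis dvd_mult mult.commute power_mult)
    hence p4: "p mod 4 = 1" using prime_dvd_square_plus_1_mod_4 p(1) odd_p by blast
    obtain a b where ab: "p ^ e + 1 = 2 ^ a * q ^ b" "a \<ge> 1"
      using prime_power_plus_1_form[OF N q(1) odd_q sN pN] unfolding e_def by blast
    have "p ^ e mod 4 = 1" using p4 by (metis mod_less one_less_numeral_iff power_mod power_one semiring_norm(76))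
    hence n4: "\<not> 4 dvd p ^ e + 1" by presburger
    have a: "a = 1"
    proof (rule ccontr)
      assume "a \<noteq> 1"
      hence "(2::nat) ^ 2 dvd 2 ^ a" using ab(2) by (intro le_imp_power_dvd) auto
      hence "4 dvd p ^ e + 1" unfolding ab(1) by simp
      thus False using n4 by blast
    qed
    have "b \<noteq> 0"
    proof
      assume "b = 0"
      hence "p ^ e = 1" using ab a by simp
      thus False using p1 e0 by simp
    qed
    hence qd: "q dvd p ^ e + 1" unfolding ab(1) by simp
    have "odd e"
    proof
      assume "even e"
      then obtain l where "e = l * 2" by (metis dvd_def mult.commute)
      hence "q dvd (p ^ l) ^ 2 + 1" using qd by (simp add: power_mult)
      thus False using prime_dvd_square_plus_1_mod_4[OF q(1) odd_q] q(2) by simp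
    qed
    hence dv: "p + 1 dvd p ^ e + 1" by (rule plus_1_dvd_odd_power_plus_1)
    then obtain i j where ij: "p + 1 = 2 ^ i * q ^ j"
      using dvd_two_prime_powers[OF two_is_prime_nat q(1)] ab(1) by metis
    have "i \<le> 1"
    proof (rule ccontr)
      assume "\<not> i \<le> 1"
      hence "(2::nat) ^ 2 dvd 2 ^ i" by (intro le_imp_power_dvd) auto
      hence "4 dvd p + 1" unfolding ij by simp
      thus False using p4 by presburger
    qed
    hence "(2::nat) ^ i \<le> 2" using power_increasing[of i 1 "2::nat"] by simp
    \<comment> \<open>With \<open>j = 0\<close> the bound on \<open>2 ^ i\<close> would give
      \<open>p + 1 \<le> 2\<close>.\<close>
    hence "j \<noteq> 0" using ij p1 by (intro notI) simp
    hence "q dvd p + 1" unfolding ij by simp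
    hence "int q dvd int (p + 1)" by (simp only: of_nat_dvd_iff)
    thus ?thesis by (simp add: cong_iff_dvd_diff add.commute)
  qed
  hence "[int M = 1] (mod int q) \<or> [int M = -1] (mod int q)"
    by (rule cong_plus_minus_1_of_prime_factors[OF M0])
  hence "int q dvd 2 * (int M - 1) \<or> int q dvd 2 * (int M + 1)"
    by (auto simp: cong_iff_dvd_diff simp del: distrib_left_numeral right_diff_distrib_numeral)
  moreover have "int q dvd 2 * int M - 1"
  proof -
    have "2 * int M - 1 = int q ^ f2" using arg_cong[OF M, of int] by simp
    thus ?thesis using f by simp
  qed
  \<comment> \<open>Eliminating \<open>M\<close> between \<open>2 * M = 1\<close> and
    \<open>M = 1\<close> or \<open>M = -1\<close> modulo \<open>q\<close> leaves the constants 1 and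
    3; this is where \<open>q \<noteq> 3\<close> enters.\<close>
  ultimately have "int q dvd (2 * int M - 1) - 2 * (int M - 1) \<or> int q dvd 2 * (int M + 1) - (2 * int M - 1)"
    using dvd_diff by blast
  hence "int q dvd 1 \<or> int q dvd 3" by simp
  hence "q dvd 1 \<or> q dvd 3" by presburger
  hence "q = 1 \<or> q = 3" using prime_nat_iff[of 3] by auto
  thus False using q by auto
qed

section \<open>The case q = 13: comparison of sizes\<close>

text \<open>A lower bound depending on \<open>a\<close> alone, so that a product of factors is
  bounded through the sum of the exponents \<open>a\<close>. Squaring avoids the root of 3/4. The
  base 3/4 is sharp at \<open>(2, 0)\<close>, and the pair \<open>(1, 0)\<close> would violate the
  bound.\<close>

lemma three_quarters_power_le_square:
  fixes a b :: nat
  assumes "a \<ge> 1" "(a, b) \<noteq> (1, 0)"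
  shows "(3/4 :: real) ^ a \<le> (1 - 1 / (2 ^ a * 13 ^ b)) ^ 2"
proof (cases "a = 1")
  case True
  hence "b \<ge> 1" using assms by (cases b) auto
  hence "(13::real) ^ 1 \<le> 13 ^ b" by (intro power_increasing) auto
  hence "1 / (2 ^ a * 13 ^ b) \<le> (1/26 :: real)" using True by (simp add: field_simps)
  hence "(25/26 :: real) ^ 2 \<le> (1 - 1 / (2 ^ a * 13 ^ b)) ^ 2" by (intro power_mono) auto
  thus ?thesis using True by (simp add: power2_eq_square)
next
  case False
  hence a: "a \<ge> 2" using assms by simp
  hence "(2::real) ^ 2 * 1 \<le> 2 ^ a * 13 ^ b" by (intro mult_mono power_increasing) auto
  hence "1 / (2 ^ a * 13 ^ b) \<le> (1/4 :: real)" by (simp add: field_simps)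
  hence "(3/4 :: real) ^ 2 \<le> (1 - 1 / (2 ^ a * 13 ^ b)) ^ 2" by (intro power_mono) auto
  moreover have "(3/4 :: real) ^ a \<le> (3/4) ^ 2" using a by (intro power_decreasing) auto
  ultimately show ?thesis by linarith
qed

text \<open>Enclosing \<open>S\<close> in a finite rectangle reduces the sum to a product of two
  geometric sums, over \<open>a \<ge> 1\<close> with limit 1 and over \<open>b \<ge> 0\<close> with
  limit 13/12.\<close>

lemma sum_reciprocals_le:
  fixes S :: "(nat \<times> nat) set"
  assumes fin: "finite S" and S: "\<And>a b. (a, b) \<in> S \<Longrightarrow> a \<ge> 1"
  shows "(\<Sum>(a, b)\<in>S. 1 / (2 ^ a * 13 ^ b)) \<le> (13/12 :: real)"
proof -
  define A B where "A = Max (insert 0 (fst ` S))" and "B = Max (insert 0 (snd ` S))"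
  have le: "a \<le> A" "b \<le> B" if "(a, b) \<in> S" for a b
    unfolding A_def B_def using that fin by (force intro!: Max_ge)+
  have "S \<subseteq> {1..A} \<times> {..B}" using le S by auto
  hence "(\<Sum>(a, b)\<in>S. 1 / (2 ^ a * 13 ^ b)) \<le> (\<Sum>(a, b)\<in>{1..A} \<times> {..B}. 1 / (2 ^ a * 13 ^ b) :: real)"
    by (intro sum_mono2) auto
  also have "\<dots> = (\<Sum>a\<in>{1..A}. (1/2) ^ a) * (\<Sum>b\<le>B. (1/13) ^ b)"
    by (simp add: sum_product sum.cartesian_product power_one_over)
  also have "(\<Sum>a\<in>{1..A}. (1/2 :: real) ^ a) = 1 - (1/2) ^ A" by (induction A) auto
  also have "(\<Sum>b\<le>B. (1/13 :: real) ^ b) = 13/12 - (1/13) ^ B / 12" by (induction B) auto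
  also have "(1 - (1/2 :: real) ^ A) * (13/12 - (1/13) ^ B / 12) \<le> 1 * (13/12)"
  proof (rule mult_mono)
    have "(1/13 :: real) ^ B \<le> 1" by (intro power_le_one) auto
    thus "0 \<le> 13/12 - (1/13 :: real) ^ B / 12" by simp
  qed auto
  finally show ?thesis by simp
qed

text \<open>The factors for \<open>4\<close> and \<open>8\<close> are split off because the estimate
  \<open>\<Prod>(1 - u) \<ge> 1 - \<Sum>u\<close> would be too weak with them. The excluded
  pairs stand for \<open>1\<close>, \<open>15\<close> and \<open>51\<close>, which are not prime powers.\<close>

lemma prod_one_minus_reciprocals_ge:
  fixes S :: "(nat \<times> nat) set"
  assumes fin: "finite S" and S: "\<And>a b. (a, b) \<in> S \<Longrightarrow> a \<ge> 1"
    and ex: "(1, 0) \<notin> S" "(4, 0) \<notin> S" "(2, 1) \<notin> S"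
  shows "(3/4) * (7/8) * (545/624 :: real) \<le> (\<Prod>(a, b)\<in>S. 1 - 1 / (2 ^ a * 13 ^ b))"
proof -
  define u :: "nat \<times> nat \<Rightarrow> real" where "u = (\<lambda>(a, b). 1 / (2 ^ a * 13 ^ b))"
  define D :: "(nat \<times> nat) set" where "D = {(2, 0), (3, 0)}"
  \<comment> \<open>\<open>E\<close> holds the pairs for 2, 4, 8, 16 and 52, none of which lies in
    \<open>S - D\<close>. Their reciprocals can thus be subtracted from 13/12, leaving 13/12 - 15/16
    - 1/52 = 79/624 = 1 - 545/624.\<close>
  define E :: "(nat \<times> nat) set" where "E = {(1, 0), (2, 0), (3, 0), (4, 0), (2, 1)}"
  have u: "u x \<in> {0..1}" for x
  proof -
    have "(1::real) * 1 \<le> 2 ^ a * 13 ^ b" for a b by (intro mult_mono one_le_power) auto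
    thus ?thesis unfolding u_def by (auto simp: split_beta divide_simps)
  qed
  have "sum u ((S - D) \<union> E) \<le> 13/12"
    unfolding u_def by (rule sum_reciprocals_le) (use fin S in \<open>auto simp: E_def\<close>)
  moreover have "sum u ((S - D) \<union> E) = sum u (S - D) + sum u E"
    by (rule sum.union_disjoint) (use fin ex in \<open>auto simp: D_def E_def\<close>)
  moreover have "sum u E = 15/16 + 1/52" by (simp add: E_def u_def)
  ultimately have "545/624 \<le> 1 - sum u (S - D)" by simp
  also have "\<dots> \<le> (\<Prod>x\<in>S - D. 1 - u x)" using u by (rule Weierstrass_prod_ineq)
  finally have 1: "545/624 \<le> (\<Prod>x\<in>S - D. 1 - u x)" .
  \<comment> \<open>\<open>S\<close> need not contain both pairs of \<open>D\<close>; a missing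
    factor is at most 1, so including it only lowers the product.\<close>
  have "(3/4) * (7/8) = (\<Prod>x\<in>D. 1 - u x)" by (simp add: D_def u_def)
  also have "\<dots> = (\<Prod>x\<in>S \<inter> D. 1 - u x) * (\<Prod>x\<in>D - S. 1 - u x)"
    using prod.Int_Diff[of D "\<lambda>x. 1 - u x" S] by (simp add: D_def Int_commute)
  also have "\<dots> \<le> (\<Prod>x\<in>S \<inter> D. 1 - u x) * 1"
    using u by (intro mult_left_mono prod_le_1 prod_nonneg) auto
  also have "\<dots> = (\<Prod>x\<in>S \<inter> D. 1 - u x)" by simp
  finally have 2: "(3/4) * (7/8) \<le> (\<Prod>x\<in>S \<inter> D. 1 - u x)" .
  have "(3/4) * (7/8) * (545/624) \<le> (\<Prod>x\<in>S \<inter> D. 1 - u x) * (\<Prod>x\<in>S - D. 1 - u x)"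
    using 1 2 by (intro mult_mono) auto
  also have "\<dots> = (\<Prod>x\<in>S. 1 - u x)"
    using prod.Int_Diff[OF fin, of "\<lambda>x. 1 - u x" D] by simp
  finally show ?thesis unfolding u_def by (simp add: split_beta)
qed

lemma prime_power_neq_mult:
  fixes p e r s :: nat
  assumes "prime p" "prime r" "prime s" "r \<noteq> s"
  shows "p ^ e \<noteq> r * s"
proof
  assume "p ^ e = r * s"
  hence "r dvd p ^ e" "s dvd p ^ e" by simp_all
  thus False using assms by (metis prime_dvd_power primes_dvd_imp_eq)
qed

lemma thirteen_impossible:
  fixes N f1 f2 :: nat
  assumes N: "N > 0" "odd N" and f: "f1 \<ge> 1" "f2 \<ge> 1"
    and sN: "unitary_sigma N = 2 ^ f1 * 13 ^ f2"
    and eq: "(2 ^ f1 + 1) * (13 ^ f2 + 1) = 2 * N"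
  shows False
proof -
  define P where "P = prime_factors N"
  define e where "e p = multiplicity p N" for p
  have fin: "finite P" unfolding P_def by simp
  have pr: "prime p" and e0: "e p > 0" if "p \<in> P" for p
    using that unfolding P_def e_def by (auto simp: prime_factors_multiplicity)
  have pr13: "prime (13::nat)" by simp
  have "\<forall>p\<in>P. \<exists>a b. p ^ e p + 1 = 2 ^ a * 13 ^ b \<and> a \<ge> 1"
    using prime_power_plus_1_form[OF N pr13 _ sN] unfolding P_def e_def by simp
  then obtain a b where ab: "\<And>p. p \<in> P \<Longrightarrow> p ^ e p + 1 = 2 ^ a p * 13 ^ b p"
    and a1: "\<And>p. p \<in> P \<Longrightarrow> a p \<ge> 1" by metis
  define g where "g p = 1 - 1 / (2 ^ a p * 13 ^ b p :: real)" for p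
  \<comment> \<open>These values would make \<open>p ^ e p + 1\<close> equal to 2, 16 or 52, that
    is, give the pairs \<open>(1, 0)\<close>, \<open>(4, 0)\<close> or
    \<open>(2, 1)\<close>.\<close>
  have nPrime: "p ^ e p \<noteq> 1" "p ^ e p \<noteq> 15" "p ^ e p \<noteq> 51" if "p \<in> P" for p
    using pr[OF that] e0[OF that] prime_power_neq_mult[of p 3 5 "e p"] prime_power_neq_mult[of p 3 17 "e p"]
      not_prime_1 by auto
  have n10: "(a p, b p) \<noteq> (1, 0)" and n40: "(a p, b p) \<noteq> (4, 0)" and n21: "(a p, b p) \<noteq> (2, 1)"
    if "p \<in> P" for p
    by (intro notI; use ab[OF that] nPrime[OF that] in simp)+
  have prodx: "(\<Prod>p\<in>P. p ^ e p + 1) = 2 ^ f1 * 13 ^ f2"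
    using unitary_sigma_eq_prod_prime_factors[OF N(1)] sN unfolding P_def e_def by simp
  have prodN: "(\<Prod>p\<in>P. p ^ e p) = N"
    using prime_factorization_nat[OF N(1)] unfolding P_def e_def by simp
  have g_alt: "g p = real (p ^ e p) / real (p ^ e p + 1)" if "p \<in> P" for p
  proof -
    have "real (p ^ e p + 1) = 2 ^ a p * 13 ^ b p" unfolding ab[OF that] by simp
    hence "g p = 1 - 1 / real (p ^ e p + 1)" unfolding g_def by simp
    moreover have "1 - 1 / (1 + y) = y / (1 + y)" if "y \<ge> 0" for y :: real
      using that by (simp add: field_simps)
    ultimately show ?thesis by simp
  qed
  have "(\<Prod>p\<in>P. g p) = (\<Prod>p\<in>P. real (p ^ e p) / real (p ^ e p + 1))"
    using g_alt by (rule prod.cong[OF refl])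
  also have "\<dots> = real (\<Prod>p\<in>P. p ^ e p) / real (\<Prod>p\<in>P. p ^ e p + 1)"
    unfolding prod_dividef of_nat_prod ..
  also have "\<dots> = real N / (2 ^ f1 * 13 ^ f2)" unfolding prodx prodN by simp
  also have "real N = (2 ^ f1 + 1) * (13 ^ f2 + 1) / 2"
    using arg_cong[OF eq, of real] by (simp add: algebra_simps)
  also have "(2 ^ f1 + 1) * (13 ^ f2 + 1) / 2 / (2 ^ f1 * 13 ^ f2)
      = (1 + 1 / 2 ^ f1) * (1 + 1 / 13 ^ f2) / (2 :: real)"
    by (simp add: field_simps)
  finally have G: "(\<Prod>p\<in>P. g p) = (1 + 1 / 2 ^ f1) * (1 + 1 / 13 ^ f2) / 2" .
  have "(13::real) ^ 1 \<le> 13 ^ f2" using f by (intro power_increasing) auto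
  hence "1 / 13 ^ f2 \<le> (1 / 13 :: real)" by (simp add: field_simps)
  hence "(1 + 1 / 2 ^ f1) * (1 + 1 / 13 ^ f2) \<le> (1 + 1 / 2 ^ f1) * (14 / 13 :: real)"
    by (intro mult_left_mono) (auto intro: add_nonneg_nonneg)
  hence G_le: "(\<Prod>p\<in>P. g p) \<le> (1 + 1 / 2 ^ f1) * (7 / 13)" unfolding G by simp
  have G_pos: "(\<Prod>p\<in>P. g p) \<ge> 0" unfolding G by (simp add: add_nonneg_nonneg)
  show False
  \<comment> \<open>Each estimate works only on its side of this cut. At \<open>f1 = 4\<close> the
    first compares 81/256, about 0.316, with (119/208)^2, about 0.327, and fails. The second has the
    lower bound 0.5732, just above 119/208, about 0.5721, but below 63/104, the upper bound at
    \<open>f1 = 3\<close>.\<close>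
  proof (cases "f1 \<le> 3")
    case True
    have "(\<Prod>p\<in>P. 2 ^ a p * 13 ^ b p) = (2 ^ f1 * 13 ^ f2 :: nat)"
      using prodx ab by simp
    hence eqn: "2 ^ (\<Sum>p\<in>P. a p) * 13 ^ (\<Sum>p\<in>P. b p) = (2 ^ f1 * 13 ^ f2 :: nat)"
      by (simp add: prod.distrib power_sum)
    \<comment> \<open>The exponent of 2 can be read off both sides of \<open>eqn\<close>.\<close>
    have "multiplicity 2 (2 ^ i * 13 ^ j :: nat) = i" for i j :: nat
      by (subst prime_elem_multiplicity_mult_distrib)
        (auto simp: multiplicity_distinct_prime_power)
    hence sum_a: "(\<Sum>p\<in>P. a p) = f1" using eqn by metis
    have "(3/4) ^ f1 = (\<Prod>p\<in>P. (3/4 :: real) ^ a p)"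
      unfolding sum_a[symmetric] by (simp add: power_sum)
    also have "\<dots> \<le> (\<Prod>p\<in>P. g p ^ 2)"
      unfolding g_def by (intro prod_mono conjI three_quarters_power_le_square a1 n10) auto
    also have "\<dots> = (\<Prod>p\<in>P. g p) ^ 2" by (simp add: prod_power_distrib)
    also have "\<dots> \<le> ((1 + 1 / 2 ^ f1) * (7 / 13)) ^ 2" using G_le G_pos by (intro power_mono) auto
    finally have "(3/4 :: real) ^ f1 \<le> ((1 + 1 / 2 ^ f1) * (7 / 13)) ^ 2" .
    moreover have "f1 = 1 \<or> f1 = 2 \<or> f1 = 3" using True f by linarith
    ultimately show False by (auto simp: power2_eq_square power3_eq_cube)
  next
    case False
    define S where "S = (\<lambda>p. (a p, b p)) ` P"
    \<comment> \<open>Powers of distinct primes differ, so each pair occurs once and the product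
      over \<open>P\<close> becomes a product over the set \<open>S\<close>.\<close>
    have inj: "inj_on (\<lambda>p. (a p, b p)) P"
    proof (rule inj_onI)
      fix p r assume pr': "p \<in> P" "r \<in> P" "(a p, b p) = (a r, b r)"
      hence "p ^ e p + 1 = r ^ e r + 1" using ab by simp
      hence "p dvd r ^ e r" using e0[OF pr'(1)] by (metis add_right_cancel dvd_power)
      thus "p = r" using pr[OF pr'(1)] pr[OF pr'(2)] by (metis prime_dvd_power primes_dvd_imp_eq)
    qed
    have "(3/4) * (7/8) * (545/624 :: real) \<le> (\<Prod>(a, b)\<in>S. 1 - 1 / (2 ^ a * 13 ^ b))"
      by (rule prod_one_minus_reciprocals_ge)
        (use fin a1 n10 n40 n21 in \<open>force simp: S_def\<close>)+
    also have "\<dots> = (\<Prod>p\<in>P. g p)"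
      unfolding S_def g_def by (subst prod.reindex[OF inj]) simp
    also have "\<dots> \<le> (1 + 1 / 2 ^ f1) * (7 / 13)" by (rule G_le)
    also have "\<dots> \<le> (1 + 1 / 16) * (7 / 13 :: real)"
    proof -
      have "(2::real) ^ 4 \<le> 2 ^ f1" using False by (intro power_increasing) auto
      hence "1 / 2 ^ f1 \<le> (1 / 16 :: real)" by (simp add: field_simps)
      hence "1 + 1 / 2 ^ f1 \<le> (1 + 1 / 16 :: real)" by (rule add_left_mono)
      thus ?thesis by (rule mult_right_mono) simp
    qed
    finally show False by simp
  qed
qed

theorem theorem5p4:
  fixes N q f1 f2 :: nat
  assumes "N > 0" and "odd N"
    and "unitary_sigma (unitary_sigma N) = 2 * N"
    and "N \<noteq> 9" and "N \<noteq> 165"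
    and "prime q" and "odd q" and "f1 \<ge> 1" and "f2 \<ge> 1"
    and "unitary_sigma N = 2 ^ f1 * q ^ f2"
  shows "q \<notin> {7, 11, 13}"
proof
  assume q: "q \<in> {7, 11, 13}"
  have "q \<noteq> 2" using \<open>odd q\<close> by auto
  hence eq: "(2 ^ f1 + 1) * (q ^ f2 + 1) = 2 * N"
    using assms unitary_sigma_two_prime_powers[of 2 q f1 f2] by simp
  show False
  proof (cases "q = 13")
    case True
    thus False using thirteen_impossible[of N f1 f2] assms eq by simp
  next
    case False
    hence "q mod 4 = 3" "q \<noteq> 3" using q by auto
    thus False using prime_3_mod_4_impossible[of N q f2 f1] assms eq by simp
  qed
qed

end
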